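(* Let $a,b$ be non-zero complex numbers with $|a|^2+|b|^2=1$, and consider the product states $|00\rangle_{AB}$ and $a|01\rangle_{AB}+b|11\rangle_{AB}$. The entangled states in $\mathbb{C}^2\otimes\mathbb{C}^2$ orthogonal to both of them are exactly the states characterized by two non-zero complex numbers $c,d$ with $|c|^2+|d|^2=1$ through the Schmidt decomposition $$|\mathrm{ppE}\rangle_{AB}=\sum_{j=0}^1\kappa_j\left(\frac{|x_j\rangle_A}{\||x_j\rangle\|}\right)\otimes\left(\frac{|y_j^*\rangle_B}{\||y_j\rangle\|}\right),$$ where $$\kappa_j=\left(\frac{1+(-1)^j\sqrt{1-4|bcd|^2}}{2}\right)^{1/2},\quad |x_j\rangle=\begin{bmatrix}b^*c(\kappa_j^2-|d|^2)\\-a^*c\,\kappa_j^2\end{bmatrix},\quad |y_j\rangle=\begin{bmatrix}-a^*cd^*\\ \kappa_j^2-|d|^2\end{bmatrix}.$$ In particular $|x_0\rangle\perp|x_1\rangle$ and $|y_0\rangle\perp|y_1\rangle$.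
   Context: $|0\rangle,|1\rangle$ is the standard basis of $\mathbb{C}^2$, $|jk\rangle_{AB}=|j\rangle_A\otimes|k\rangle_B$, column vectors are with respect to the standard basis, $^*$ on scalars is complex conjugation, and $|y^*\rangle$ is the entrywise complex conjugate of $|y\rangle$. A state is a unit vector; a state in $\mathbb{C}^2\otimes\mathbb{C}^2$ is a product state if it equals $|u\rangle\otimes|v\rangle$, and entangled otherwise. A Schmidt decomposition of a state is an expression $\sum_j\lambda_j|u_j\rangle\otimes|v_j\rangle$ with $\lambda_j\ge 0$ (the Schmidt coefficients) and $\{|u_j\rangle\}$, $\{|v_j\rangle\}$ orthonormal families in $\mathbb{C}^2$. *)

theory Defs
  imports "HOL-Analysis.Analysis"
begin

text \<open>The library inner product on \<^typ>\<open>complex ^ 'n\<close> is real-valued (the real part of the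
  Hermitian one), so the Hermitian inner product, antilinear in its first argument, is defined here.
  The library norm on \<^typ>\<open>complex ^ 'n\<close> is the Hermitian norm.\<close>

definition cinner :: "complex ^ 'n \<Rightarrow> complex ^ 'n \<Rightarrow> complex" where
  "cinner u v = (\<Sum>i\<in>UNIV. cnj (u $ i) * v $ i)"

definition cperp :: "complex ^ 'n \<Rightarrow> complex ^ 'n \<Rightarrow> bool" where
  "cperp u v \<longleftrightarrow> cinner u v = 0"

definition vcnj :: "complex ^ 'n \<Rightarrow> complex ^ 'n" where
  "vcnj v = (\<chi> i. cnj (v $ i))"

text \<open>The tensor product of two coordinate spaces is the coordinate space over the product of the
  index types.\<close>

definition tensor :: "complex ^ 'm \<Rightarrow> complex ^ 'n \<Rightarrow> complex ^ ('m::finite \<times> 'n::finite)"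
    (infixr "\<otimes>\<^sub>v" 75) where
  "u \<otimes>\<^sub>v v = (\<chi> p. u $ fst p * v $ snd p)"

definition is_state :: "complex ^ 'n \<Rightarrow> bool" where
  "is_state \<psi> \<longleftrightarrow> norm \<psi> = 1"

definition product_state :: "complex ^ ('m::finite \<times> 'n::finite) \<Rightarrow> bool" where
  "product_state \<psi> \<longleftrightarrow> is_state \<psi> \<and> (\<exists>u v. \<psi> = u \<otimes>\<^sub>v v)"

definition entangled_state :: "complex ^ ('m::finite \<times> 'n::finite) \<Rightarrow> bool" where
  "entangled_state \<psi> \<longleftrightarrow> is_state \<psi> \<and> \<not> product_state \<psi>"

definition orthonormal_family :: "'i set \<Rightarrow> ('i \<Rightarrow> complex ^ 'n) \<Rightarrow> bool" where
  "orthonormal_family J u \<longleftrightarrow>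
     (\<forall>i\<in>J. \<forall>j\<in>J. cinner (u i) (u j) = (if i = j then 1 else 0))"

definition schmidt_decomposition ::
    "complex ^ ('m::finite \<times> 'n::finite) \<Rightarrow> 'i set \<Rightarrow> ('i \<Rightarrow> real) \<Rightarrow> ('i \<Rightarrow> complex ^ 'm) \<Rightarrow> ('i \<Rightarrow> complex ^ 'n) \<Rightarrow> bool"
  where
  "schmidt_decomposition \<psi> J l u v \<longleftrightarrow>
     finite J \<and> (\<forall>j\<in>J. 0 \<le> l j) \<and> orthonormal_family J u \<and> orthonormal_family J v \<and>
     \<psi> = (\<Sum>j\<in>J. l j *\<^sub>R (u j \<otimes>\<^sub>v v j))"

text \<open>The components of \<^term>\<open>vector [p, q] :: complex ^ 2\<close> have indices 1 and 2, so the basis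
  vector labelled 0 (resp. 1) has its nonzero entry at index 1 (resp. 2).\<close>

definition ket0 :: "complex ^ 2" where "ket0 = vector [1, 0]"
definition ket1 :: "complex ^ 2" where "ket1 = vector [0, 1]"

definition kappa :: "complex \<Rightarrow> complex \<Rightarrow> complex \<Rightarrow> nat \<Rightarrow> real" where
  "kappa b c d j = sqrt ((1 + (-1) ^ j * sqrt (1 - 4 * (cmod (b * c * d))\<^sup>2)) / 2)"

definition xvec :: "complex \<Rightarrow> complex \<Rightarrow> complex \<Rightarrow> complex \<Rightarrow> nat \<Rightarrow> complex ^ 2" where
  "xvec a b c d j = vector
     [cnj b * c * of_real ((kappa b c d j)\<^sup>2 - (cmod d)\<^sup>2),
      - cnj a * c * of_real ((kappa b c d j)\<^sup>2)]"

definition yvec :: "complex \<Rightarrow> complex \<Rightarrow> complex \<Rightarrow> complex \<Rightarrow> nat \<Rightarrow> complex ^ 2" where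
  "yvec a b c d j = vector
     [- cnj a * c * cnj d,
      of_real ((kappa b c d j)\<^sup>2 - (cmod d)\<^sup>2)]"

definition ppE :: "complex \<Rightarrow> complex \<Rightarrow> complex \<Rightarrow> complex \<Rightarrow> complex ^ (2 \<times> 2)" where
  "ppE a b c d =
     (\<Sum>j\<in>{0..1}. kappa b c d j *\<^sub>R
        ((xvec a b c d j /\<^sub>R norm (xvec a b c d j)) \<otimes>\<^sub>v
         (vcnj (yvec a b c d j) /\<^sub>R norm (yvec a b c d j))))"

end

theory Submission
  imports Defs
begin

text \<open>A vector orthogonal to both product states has coefficient matrix
  \<open>M = [[0, b\<^sup>* c], [d, - a\<^sup>* c]]\<close>, which is a unit vector iff \<open>|c|\<^sup>2 + |d|\<^sup>2 = 1\<close> and has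
  rank 2 iff \<open>c, d \<noteq> 0\<close>. The numbers \<open>k\<^sub>j = \<kappa>\<^sub>j\<^sup>2\<close> are the roots of \<open>k\<^sup>2 - k + |b c d|\<^sup>2\<close>, which is
  the characteristic polynomial of \<open>M M\<^sup>\<dagger>\<close>; they are distinct because \<open>|b| < 1\<close> and
  \<open>|c d| \<le> 1/2\<close>. The singular vectors are \<open>y\<^sub>j\<close> and \<open>x\<^sub>j = M y\<^sub>j\<close>, with
  \<open>\<parallel>x\<^sub>j\<parallel> = \<kappa>\<^sub>j \<parallel>y\<^sub>j\<parallel>\<close>. With \<open>p = k\<^sub>0 - |d|\<^sup>2\<close> and \<open>q = k\<^sub>1 - |d|\<^sup>2\<close> one has \<open>p q = - |a c d|\<^sup>2\<close>, hence
  \<open>\<parallel>y\<^sub>0\<parallel>\<^sup>2 = p (p - q)\<close> and \<open>\<parallel>y\<^sub>1\<parallel>\<^sup>2 = q (q - p)\<close>, which makes all entries computable.\<close>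

section \<open>Coordinates, norms and Hermitian inner products\<close>

lemma sum_UNIV_2x2:
  fixes f :: "2 \<times> 2 \<Rightarrow> 'a::comm_monoid_add"
  shows "(\<Sum>p\<in>UNIV. f p) = f (1,1) + f (1,2) + (f (2,1) + f (2,2))"
proof -
  have "(\<Sum>p\<in>UNIV. f p) = (\<Sum>i\<in>UNIV. \<Sum>j\<in>UNIV. f (i, j))"
    by (simp add: sum.cartesian_product)
  then show ?thesis by (simp add: sum_2)
qed

lemma vec_eq_iff_2x2:
  fixes \<psi> \<phi> :: "'a ^ (2 \<times> 2)"
  shows "\<psi> = \<phi> \<longleftrightarrow> \<psi> $ (1,1) = \<phi> $ (1,1) \<and> \<psi> $ (1,2) = \<phi> $ (1,2)
    \<and> \<psi> $ (2,1) = \<phi> $ (2,1) \<and> \<psi> $ (2,2) = \<phi> $ (2,2)"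
  by (auto simp: vec_eq_iff forall_2)

lemma norm_vec_sq:
  fixes v :: "complex ^ 'n"
  shows "(norm v)\<^sup>2 = (\<Sum>i\<in>UNIV. (cmod (v $ i))\<^sup>2)"
  by (simp add: norm_vec_def L2_set_def sum_nonneg)

lemma cinner_self: "cinner v v = of_real ((norm v)\<^sup>2)"
  by (simp add: cinner_def norm_vec_sq complex_norm_square mult.commute del: of_real_power)

lemma cinner_scaleR: "cinner (r *\<^sub>R u) (s *\<^sub>R v) = of_real (r * s) * cinner u v"
  unfolding cinner_def sum_distrib_left
  by (rule sum.cong) (simp_all add: scaleR_conv_of_real[symmetric])

lemma cinner_commute: "cinner v u = cnj (cinner u v)"
  by (simp add: cinner_def mult.commute)

lemma cinner_vcnj: "cinner (vcnj u) (vcnj v) = cnj (cinner u v)"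
  by (simp add: cinner_def vcnj_def)

lemma norm_vcnj: "norm (vcnj v) = norm v"
  by (simp add: norm_vec_def vcnj_def)

lemma orthonormal_family_normalized:
  fixes u :: "nat \<Rightarrow> complex ^ 'n"
  assumes "u 0 \<noteq> 0" "u 1 \<noteq> 0" "cperp (u 0) (u 1)"
  shows "orthonormal_family {0..1} (\<lambda>j. u j /\<^sub>R norm (u j))"
proof -
  have "cinner (u 0) (u 1) = 0" "cinner (u 1) (u 0) = 0"
    using assms(3) cinner_commute[of "u 1" "u 0"] by (simp_all add: cperp_def)
  moreover have "{0..1::nat} = {0, 1}" by auto
  ultimately show ?thesis
    using assms(1,2)
    by (simp add: orthonormal_family_def cinner_scaleR cinner_self power2_eq_square field_simps)
qed

text \<open>Read as a 2x2 coefficient matrix, a tensor product is a matrix of rank at most 1, which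
  is detected by the determinant.\<close>

lemma tensor_2x2_iff:
  fixes \<psi> :: "complex ^ (2 \<times> 2)"
  shows "(\<exists>u v. \<psi> = u \<otimes>\<^sub>v v) \<longleftrightarrow> \<psi> $ (1,1) * \<psi> $ (2,2) = \<psi> $ (1,2) * \<psi> $ (2,1)"
proof
  assume "\<exists>u v. \<psi> = u \<otimes>\<^sub>v v"
  then show "\<psi> $ (1,1) * \<psi> $ (2,2) = \<psi> $ (1,2) * \<psi> $ (2,1)"
    by (auto simp: tensor_def)
next
  assume det: "\<psi> $ (1,1) * \<psi> $ (2,2) = \<psi> $ (1,2) * \<psi> $ (2,1)"
  \<comment> \<open>A nonzero first row serves as \<open>v\<close>, and the second entry of
    \<open>u\<close> is the ratio of the rows, read off in a column where the first row does not
    vanish. If the first row is zero, the second row serves as \<open>v\<close>.\<close>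
  consider "\<psi> $ (1,1) \<noteq> 0" | "\<psi> $ (1,2) \<noteq> 0" | "\<psi> $ (1,1) = 0" "\<psi> $ (1,2) = 0" by blast
  then show "\<exists>u v. \<psi> = u \<otimes>\<^sub>v v"
  proof cases
    case 1
    then have "\<psi> = vector [1, \<psi> $ (2,1) / \<psi> $ (1,1)] \<otimes>\<^sub>v vector [\<psi> $ (1,1), \<psi> $ (1,2)]"
      using det by (simp add: vec_eq_iff_2x2 tensor_def field_simps)
    then show ?thesis by blast
  next
    case 2
    then have "\<psi> = vector [1, \<psi> $ (2,2) / \<psi> $ (1,2)] \<otimes>\<^sub>v vector [\<psi> $ (1,1), \<psi> $ (1,2)]"
      using det by (simp add: vec_eq_iff_2x2 tensor_def field_simps)
    then show ?thesis by blast
  next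
    case 3
    then have "\<psi> = vector [0, 1] \<otimes>\<^sub>v vector [\<psi> $ (2,1), \<psi> $ (2,2)]"
      by (simp add: vec_eq_iff_2x2 tensor_def)
    then show ?thesis by blast
  qed
qed

section \<open>Schmidt coefficients and singular vectors for fixed \<open>a\<close>,
  \<open>b\<close>, \<open>c\<close>, \<open>d\<close>\<close>

context
  fixes a b c d :: complex
  assumes nz: "a \<noteq> 0" "b \<noteq> 0" "c \<noteq> 0" "d \<noteq> 0"
    and ab: "(cmod a)\<^sup>2 + (cmod b)\<^sup>2 = 1"
    and cd: "(cmod c)\<^sup>2 + (cmod d)\<^sup>2 = 1"
begin

text \<open>Strictness comes from \<open>a\<close> being nonzero, which forces |b| < 1; it is what
  separates the two roots in \<open>kappa_sq_neq\<close>.\<close>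

lemma discriminant_pos: "4 * (cmod (b * c * d))\<^sup>2 < 1"
proof -
  have "4 * ((cmod c)\<^sup>2 * (cmod d)\<^sup>2) = 1 - ((cmod c)\<^sup>2 - (cmod d)\<^sup>2)\<^sup>2"
    using cd by algebra
  then have le: "4 * ((cmod c)\<^sup>2 * (cmod d)\<^sup>2) \<le> 1"
    by simp
  have "0 < (cmod a)\<^sup>2" using nz by simp
  then have "(cmod b)\<^sup>2 < 1" using ab by linarith
  then have "(cmod b)\<^sup>2 * (4 * ((cmod c)\<^sup>2 * (cmod d)\<^sup>2)) < 1 * (4 * ((cmod c)\<^sup>2 * (cmod d)\<^sup>2))"
    by (rule mult_strict_right_mono) (use nz in simp)
  then show ?thesis using le
    by (simp add: norm_mult power_mult_distrib mult_ac)
qed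

lemma kappa_sq: "(kappa b c d j)\<^sup>2 = (1 + (-1) ^ j * sqrt (1 - 4 * (cmod (b * c * d))\<^sup>2)) / 2"
proof -
  define s where "s = sqrt (1 - 4 * (cmod (b * c * d))\<^sup>2)"
  have "0 \<le> s" "s \<le> 1" using discriminant_pos by (simp_all add: s_def)
  then show ?thesis
    unfolding kappa_def s_def[symmetric] by (cases "even j") simp_all
qed

lemma kappa_sq_sum: "(kappa b c d 0)\<^sup>2 + (kappa b c d 1)\<^sup>2 = 1"
  by (simp add: kappa_sq field_simps)

lemma kappa_sq_prod:
  "(kappa b c d 0)\<^sup>2 * (kappa b c d 1)\<^sup>2 = (cmod b)\<^sup>2 * (cmod c)\<^sup>2 * (cmod d)\<^sup>2"
proof -
  define s where "s = sqrt (1 - 4 * (cmod (b * c * d))\<^sup>2)"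
  have "s\<^sup>2 = 1 - 4 * (cmod (b * c * d))\<^sup>2"
    using discriminant_pos by (simp add: s_def)
  then have "s\<^sup>2 = 1 - 4 * ((cmod b)\<^sup>2 * (cmod c)\<^sup>2 * (cmod d)\<^sup>2)"
    by (simp add: norm_mult power_mult_distrib)
  moreover have "(kappa b c d 0)\<^sup>2 * (kappa b c d 1)\<^sup>2 = (1 - s\<^sup>2) / 4"
    unfolding kappa_sq s_def[symmetric] by (simp add: field_simps power2_eq_square)
  ultimately show ?thesis by simp
qed

lemma kappa_sq_neq: "(kappa b c d 0)\<^sup>2 \<noteq> (kappa b c d 1)\<^sup>2"
  using discriminant_pos by (simp add: kappa_sq)

text \<open>Since b c d is nonzero, the inner root \<open>s\<close> is below 1, so even the smaller
  value (1 - s)/2 stays positive.\<close>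

lemma kappa_pos: "0 < kappa b c d j"
proof -
  define s where "s = sqrt (1 - 4 * (cmod (b * c * d))\<^sup>2)"
  have "0 < s" "s < 1" using discriminant_pos nz by (simp_all add: s_def)
  then show ?thesis
    unfolding kappa_def s_def[symmetric] by (cases "even j") simp_all
qed

text \<open>Vieta: the sum and the product of the two squares determine their common
  quadratic.\<close>

lemma kappa_sq_root:
  assumes "j \<in> {0..1}"
  shows "(kappa b c d j)\<^sup>2 * (kappa b c d j)\<^sup>2
    = (kappa b c d j)\<^sup>2 - (cmod b)\<^sup>2 * (cmod c)\<^sup>2 * (cmod d)\<^sup>2"
proof -
  consider "j = 0" | "j = 1" using assms by force
  then show ?thesis
  proof cases
    case 1
    show ?thesis unfolding 1 using kappa_sq_sum kappa_sq_prod by algebra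
  next
    case 2
    show ?thesis unfolding 2 using kappa_sq_sum kappa_sq_prod by algebra
  qed
qed

text \<open>The left side is the quadratic t^2 - t + |bcd|^2 evaluated at t = |d|^2; there t - 1 =
  -|c|^2 and 1 - |b|^2 = |a|^2.\<close>

lemma kappa_gap_prod:
  "((kappa b c d 0)\<^sup>2 - (cmod d)\<^sup>2) * ((kappa b c d 1)\<^sup>2 - (cmod d)\<^sup>2)
    = - ((cmod a)\<^sup>2 * (cmod c)\<^sup>2 * (cmod d)\<^sup>2)"
  using kappa_sq_sum kappa_sq_prod ab cd by algebra

lemma norm_yvec_sq:
  "(norm (yvec a b c d j))\<^sup>2
    = (cmod a)\<^sup>2 * (cmod c)\<^sup>2 * (cmod d)\<^sup>2 + ((kappa b c d j)\<^sup>2 - (cmod d)\<^sup>2)\<^sup>2"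
  by (simp add: norm_vec_sq sum_2 yvec_def norm_mult power_mult_distrib
      del: of_real_power of_real_diff)

lemma norm_xvec_sq:
  "(norm (xvec a b c d j))\<^sup>2
    = (cmod c)\<^sup>2 * ((cmod b)\<^sup>2 * ((kappa b c d j)\<^sup>2 - (cmod d)\<^sup>2)\<^sup>2
        + (cmod a)\<^sup>2 * ((kappa b c d j)\<^sup>2)\<^sup>2)"
  by (simp add: norm_vec_sq sum_2 xvec_def norm_mult power_mult_distrib algebra_simps
      del: of_real_power of_real_diff)

lemma norm_xvec:
  assumes "j \<in> {0..1}"
  shows "norm (xvec a b c d j) = kappa b c d j * norm (yvec a b c d j)"
proof -
  have "(norm (xvec a b c d j))\<^sup>2 = (kappa b c d j * norm (yvec a b c d j))\<^sup>2"
    \<comment> \<open>Both squared norms are polynomials in the squared coefficient; the quadratic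
      of \<open>kappa_sq_root\<close> reduces them to the same form.\<close>
    unfolding power_mult_distrib norm_xvec_sq norm_yvec_sq
    using kappa_sq_root[OF assms] ab cd by algebra
  then show ?thesis using kappa_pos[of j] by simp
qed

lemma yvec_nonzero: "yvec a b c d j \<noteq> 0"
  using nz by (simp add: vec_eq_iff forall_2 yvec_def)

lemma xvec_nonzero: "xvec a b c d j \<noteq> 0"
  using nz kappa_pos[of j] by (simp add: vec_eq_iff forall_2 xvec_def)

text \<open>The first entries contribute |acd|^2, and the second entries contribute the gap product,
  which is its negative.\<close>

lemma cperp_yvec: "cperp (yvec a b c d 0) (yvec a b c d 1)"
proof -
  have "cinner (yvec a b c d 0) (yvec a b c d 1) =
     of_real ((cmod a)\<^sup>2 * (cmod c)\<^sup>2 * (cmod d)\<^sup>2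
       + ((kappa b c d 0)\<^sup>2 - (cmod d)\<^sup>2) * ((kappa b c d 1)\<^sup>2 - (cmod d)\<^sup>2))"
    by (simp add: cinner_def sum_2 yvec_def complex_norm_square del: of_real_power)
  then show ?thesis unfolding cperp_def kappa_gap_prod by simp
qed

text \<open>Up to the factor |c|^2, the gap product contributes -|abcd|^2 and the product of the
  roots contributes +|abcd|^2.\<close>

lemma cperp_xvec: "cperp (xvec a b c d 0) (xvec a b c d 1)"
proof -
  have "cinner (xvec a b c d 0) (xvec a b c d 1) =
     of_real ((cmod c)\<^sup>2 * ((cmod b)\<^sup>2 *
       (((kappa b c d 0)\<^sup>2 - (cmod d)\<^sup>2) * ((kappa b c d 1)\<^sup>2 - (cmod d)\<^sup>2))
       + (cmod a)\<^sup>2 * ((kappa b c d 0)\<^sup>2 * (kappa b c d 1)\<^sup>2)))"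
    by (simp add: cinner_def sum_2 xvec_def complex_norm_square del: of_real_power)
      (simp add: algebra_simps)
  then show ?thesis unfolding cperp_def kappa_gap_prod kappa_sq_prod by simp
qed

section \<open>The entries of \<open>ppE\<close>\<close>

lemma ppE_eq:
  "ppE a b c d = (\<Sum>j\<in>{0..1}.
     (1 / (norm (yvec a b c d j))\<^sup>2) *\<^sub>R (xvec a b c d j \<otimes>\<^sub>v vcnj (yvec a b c d j)))"
  unfolding ppE_def
proof (rule sum.cong[OF refl])
  fix j :: nat
  assume "j \<in> {0..1}"
  then show "kappa b c d j *\<^sub>R ((xvec a b c d j /\<^sub>R norm (xvec a b c d j)) \<otimes>\<^sub>v
         (vcnj (yvec a b c d j) /\<^sub>R norm (yvec a b c d j)))
    = (1 / (norm (yvec a b c d j))\<^sup>2) *\<^sub>R (xvec a b c d j \<otimes>\<^sub>v vcnj (yvec a b c d j))"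
    \<comment> \<open>By \<open>norm_xvec\<close>, the coefficient divided by both norms is 1 /
      |y_j|^2, so no square roots of norms remain.\<close>
    using kappa_pos[of j] yvec_nonzero[of j]
    by (simp add: vec_eq_iff tensor_def norm_xvec scaleR_conv_of_real[where 'a = complex]
        field_simps power2_eq_square)
qed

text \<open>These are the scalar factors that occur, in this order, in the entries (1,1), (1,2),
  (2,1), (2,2) of \<open>ppE\<close>.\<close>

lemma weighted_sums:
  fixes k :: "nat \<Rightarrow> real" and N :: "nat \<Rightarrow> real" and D :: real
  defines "k \<equiv> \<lambda>j. (kappa b c d j)\<^sup>2" and "N \<equiv> \<lambda>j. (norm (yvec a b c d j))\<^sup>2"
    and "D \<equiv> (cmod d)\<^sup>2"
  shows "(k 0 - D) / N 0 + (k 1 - D) / N 1 = 0"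
    and "(k 0 - D)\<^sup>2 / N 0 + (k 1 - D)\<^sup>2 / N 1 = 1"
    and "(cmod a)\<^sup>2 * (cmod c)\<^sup>2 * (k 0 / N 0 + k 1 / N 1) = 1"
    and "k 0 * (k 0 - D) / N 0 + k 1 * (k 1 - D) / N 1 = 1"
proof -
  define p q where "p = k 0 - D" and "q = k 1 - D"
  define E where "E = (cmod a)\<^sup>2 * (cmod c)\<^sup>2"
  have pq: "p * q = - (E * D)"
    using kappa_gap_prod by (simp add: p_def q_def k_def D_def E_def)
  have D: "D \<noteq> 0" and "E \<noteq> 0" using nz by (simp_all add: D_def E_def)
  then have "p * q \<noteq> 0" using pq by simp
  then have p: "p \<noteq> 0" and q: "q \<noteq> 0" by simp_all
  have dif: "p - q \<noteq> 0" using kappa_sq_neq by (simp add: p_def q_def k_def)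
  have "N 0 = E * D + p\<^sup>2" "N 1 = E * D + q\<^sup>2"
    by (simp_all add: N_def norm_yvec_sq E_def D_def p_def q_def k_def)
  \<comment> \<open>Replacing \<open>E * D\<close> by -pq factors both norms; the factors are
    nonzero because the roots are distinct.\<close>
  then have N: "N 0 = p * (p - q)" "N 1 = - q * (p - q)"
    using pq by (algebra, algebra)
  have k: "k 0 = p + D" "k 1 = q + D" by (simp_all add: p_def q_def)
  have E: "E = - (p * q) / D" using pq D by (simp add: field_simps)
  show "(k 0 - D) / N 0 + (k 1 - D) / N 1 = 0"
    "(k 0 - D)\<^sup>2 / N 0 + (k 1 - D)\<^sup>2 / N 1 = 1"
    "k 0 * (k 0 - D) / N 0 + k 1 * (k 1 - D) / N 1 = 1"
    unfolding N k using p q dif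
    by (simp_all add: divide_simps) (simp_all add: algebra_simps power2_eq_square)
  \<comment> \<open>After cancelling p - q the bracket is -D/(pq), the inverse of
    \<open>E\<close>.\<close>
  have "E * (k 0 / N 0 + k 1 / N 1) = 1"
    unfolding N k E using p q dif D
    by (simp add: divide_simps) (simp add: algebra_simps)
  then show "(cmod a)\<^sup>2 * (cmod c)\<^sup>2 * (k 0 / N 0 + k 1 / N 1) = 1"
    by (simp add: E_def)
qed

text \<open>Since x_j = M y_j, the sum of x_j y_j^\<dagger> / |y_j|^2 is M times the identity,
  resolved in the orthogonal basis y_0, y_1. The proof checks this entry by entry.\<close>

lemma ppE_nth:
  "ppE a b c d $ (1,1) = 0" "ppE a b c d $ (1,2) = cnj b * c"
  "ppE a b c d $ (2,1) = d" "ppE a b c d $ (2,2) = - cnj a * c"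
proof -
  define k N where "k = (\<lambda>j. (kappa b c d j)\<^sup>2)" and "N = (\<lambda>j. (norm (yvec a b c d j))\<^sup>2)"
  define D where "D = (cmod d)\<^sup>2"
  have w: "(k 0 - D) / N 0 + (k 1 - D) / N 1 = 0"
    "(k 0 - D)\<^sup>2 / N 0 + (k 1 - D)\<^sup>2 / N 1 = 1"
    "(cmod a)\<^sup>2 * (cmod c)\<^sup>2 * (k 0 / N 0 + k 1 / N 1) = 1"
    "k 0 * (k 0 - D) / N 0 + k 1 * (k 1 - D) / N 1 = 1"
    unfolding k_def N_def D_def by (fact weighted_sums)+
  have s: "ppE a b c d $ p = (xvec a b c d 0 \<otimes>\<^sub>v vcnj (yvec a b c d 0)) $ p / of_real (N 0)
     + (xvec a b c d 1 \<otimes>\<^sub>v vcnj (yvec a b c d 1)) $ p / of_real (N 1)" for p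
    by (simp add: ppE_eq N_def scaleR_conv_of_real[where 'a = complex])
  have x: "xvec a b c d j = vector [cnj b * c * of_real (k j - D), - cnj a * c * of_real (k j)]"
    and y: "yvec a b c d j = vector [- cnj a * c * cnj d, of_real (k j - D)]" for j
    by (simp_all add: xvec_def yvec_def k_def D_def)
  have "ppE a b c d $ (1,1) = - (a * cnj b * c * cnj c * d)
      * of_real ((k 0 - D) / N 0 + (k 1 - D) / N 1)"
    unfolding s x y by (simp add: tensor_def vcnj_def algebra_simps add_divide_distrib diff_divide_distrib)
  then show "ppE a b c d $ (1,1) = 0" unfolding w by simp
  have "ppE a b c d $ (1,2) = cnj b * c
      * of_real ((k 0 - D)\<^sup>2 / N 0 + (k 1 - D)\<^sup>2 / N 1)"
    unfolding s x y by (simp add: tensor_def vcnj_def algebra_simps power2_eq_square add_divide_distrib diff_divide_distrib)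
  then show "ppE a b c d $ (1,2) = cnj b * c" unfolding w by simp
  have "ppE a b c d $ (2,1) = d
      * of_real ((cmod a)\<^sup>2 * (cmod c)\<^sup>2 * (k 0 / N 0 + k 1 / N 1))"
    unfolding s x y by (simp add: tensor_def vcnj_def complex_norm_square algebra_simps del: of_real_power)
  then show "ppE a b c d $ (2,1) = d" unfolding w by simp
  have "ppE a b c d $ (2,2) = - cnj a * c
      * of_real (k 0 * (k 0 - D) / N 0 + k 1 * (k 1 - D) / N 1)"
    unfolding s x y by (simp add: tensor_def vcnj_def algebra_simps add_divide_distrib diff_divide_distrib)
  then show "ppE a b c d $ (2,2) = - cnj a * c" unfolding w by simp
qed

lemma schmidt_decomposition_ppE:
  "schmidt_decomposition (ppE a b c d) {0..1} (kappa b c d)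
     (\<lambda>j. xvec a b c d j /\<^sub>R norm (xvec a b c d j))
     (\<lambda>j. vcnj (yvec a b c d j) /\<^sub>R norm (yvec a b c d j))"
proof -
  have "orthonormal_family {0..1} (\<lambda>j. xvec a b c d j /\<^sub>R norm (xvec a b c d j))"
    by (intro orthonormal_family_normalized xvec_nonzero cperp_xvec)
  \<comment> \<open>Entrywise conjugation preserves norms and conjugates inner products, so
    orthogonality carries over from \<open>yvec\<close>.\<close>
  moreover have "orthonormal_family {0..1}
      (\<lambda>j. vcnj (yvec a b c d j) /\<^sub>R norm (vcnj (yvec a b c d j)))"
  proof (rule orthonormal_family_normalized)
    have "norm (vcnj (yvec a b c d j)) \<noteq> 0" for j
      using yvec_nonzero by (simp add: norm_vcnj)
    then show "vcnj (yvec a b c d 0) \<noteq> 0" "vcnj (yvec a b c d 1) \<noteq> 0"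
      by (metis norm_zero)+
    show "cperp (vcnj (yvec a b c d 0)) (vcnj (yvec a b c d 1))"
      using cperp_yvec by (simp add: cperp_def cinner_vcnj)
  qed
  ultimately show ?thesis
    using kappa_pos
    by (simp add: schmidt_decomposition_def ppE_def norm_vcnj less_imp_le del: sum.cl_ivl_Suc)
qed

end

section \<open>Entangled states orthogonal to both product states\<close>

lemma orthogonal_entangled_iff:
  fixes \<psi> :: "complex ^ (2 \<times> 2)"
  assumes nz: "a \<noteq> 0" "b \<noteq> 0" and ab: "(cmod a)\<^sup>2 + (cmod b)\<^sup>2 = 1"
  shows "entangled_state \<psi> \<and> cperp (ket0 \<otimes>\<^sub>v ket0) \<psi>
      \<and> cperp (a *s (ket0 \<otimes>\<^sub>v ket1) + b *s (ket1 \<otimes>\<^sub>v ket1)) \<psi>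
    \<longleftrightarrow> (\<exists>c d. c \<noteq> 0 \<and> d \<noteq> 0 \<and> (cmod c)\<^sup>2 + (cmod d)\<^sup>2 = 1
      \<and> \<psi> $ (1,1) = 0 \<and> \<psi> $ (1,2) = cnj b * c \<and> \<psi> $ (2,1) = d \<and> \<psi> $ (2,2) = - cnj a * c)"
    (is "?L \<longleftrightarrow> ?R")
proof -
  have perp: "cperp (ket0 \<otimes>\<^sub>v ket0) \<psi> \<longleftrightarrow> \<psi> $ (1,1) = 0"
    "cperp (a *s (ket0 \<otimes>\<^sub>v ket1) + b *s (ket1 \<otimes>\<^sub>v ket1)) \<psi>
      \<longleftrightarrow> cnj a * \<psi> $ (1,2) + cnj b * \<psi> $ (2,2) = 0"
    by (simp_all add: cperp_def cinner_def sum_UNIV_2x2 tensor_def ket0_def ket1_def)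
  have ent: "entangled_state \<psi> \<longleftrightarrow>
      norm \<psi> = 1 \<and> \<psi> $ (1,1) * \<psi> $ (2,2) \<noteq> \<psi> $ (1,2) * \<psi> $ (2,1)"
    unfolding entangled_state_def product_state_def is_state_def tensor_2x2_iff by blast
  have norm: "norm \<psi> = 1 \<longleftrightarrow> (cmod c)\<^sup>2 + (cmod d)\<^sup>2 = 1"
    if "\<psi> $ (1,1) = 0" "\<psi> $ (1,2) = cnj b * c" "\<psi> $ (2,1) = d" "\<psi> $ (2,2) = - cnj a * c" for c d
  proof -
    have "(norm \<psi>)\<^sup>2 = ((cmod a)\<^sup>2 + (cmod b)\<^sup>2) * (cmod c)\<^sup>2 + (cmod d)\<^sup>2"
      by (simp add: norm_vec_sq sum_UNIV_2x2 that norm_mult power_mult_distrib algebra_simps)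
    moreover have "norm \<psi> = 1 \<longleftrightarrow> (norm \<psi>)\<^sup>2 = 1"
      by (metis norm_ge_zero one_power2 power2_eq_iff_nonneg zero_le_one)
    ultimately show ?thesis by (simp add: ab)
  qed
  show ?thesis
  proof
    assume L: ?L
    define c where "c = \<psi> $ (1,2) / cnj b"
    have entries: "\<psi> $ (1,1) = 0" "\<psi> $ (1,2) = cnj b * c" "\<psi> $ (2,2) = - cnj a * c"
      using L nz unfolding perp by (simp_all add: c_def field_simps eq_neg_iff_add_eq_0)
    \<comment> \<open>As the (1,1) entry vanishes, a nonzero determinant means that both
      off-diagonal entries are nonzero.\<close>
    moreover have "c \<noteq> 0" "\<psi> $ (2,1) \<noteq> 0"
      using L entries unfolding ent by auto
    moreover have "(cmod c)\<^sup>2 + (cmod (\<psi> $ (2,1)))\<^sup>2 = 1"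
      using L norm[OF entries(1,2) refl entries(3)] unfolding ent by simp
    ultimately show ?R by blast
  next
    assume ?R
    then obtain c d where "c \<noteq> 0" "d \<noteq> 0" "(cmod c)\<^sup>2 + (cmod d)\<^sup>2 = 1"
      and entries: "\<psi> $ (1,1) = 0" "\<psi> $ (1,2) = cnj b * c" "\<psi> $ (2,1) = d" "\<psi> $ (2,2) = - cnj a * c"
      by blast
    then show ?L
      using nz norm[OF entries] unfolding perp ent by simp
  qed
qed

theorem proposition11:
  fixes a b :: complex
  assumes "a \<noteq> 0" and "b \<noteq> 0" and "(cmod a)\<^sup>2 + (cmod b)\<^sup>2 = 1"
  shows "{\<psi> :: complex ^ (2 \<times> 2). entangled_state \<psi>
            \<and> cperp (ket0 \<otimes>\<^sub>v ket0) \<psi>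
            \<and> cperp (a *s (ket0 \<otimes>\<^sub>v ket1) + b *s (ket1 \<otimes>\<^sub>v ket1)) \<psi>}
         = {ppE a b c d | c d. c \<noteq> 0 \<and> d \<noteq> 0 \<and> (cmod c)\<^sup>2 + (cmod d)\<^sup>2 = 1}
       \<and> (\<forall>c d. c \<noteq> 0 \<and> d \<noteq> 0 \<and> (cmod c)\<^sup>2 + (cmod d)\<^sup>2 = 1 \<longrightarrow>
            schmidt_decomposition (ppE a b c d) {0..1} (kappa b c d)
              (\<lambda>j. xvec a b c d j /\<^sub>R norm (xvec a b c d j))
              (\<lambda>j. vcnj (yvec a b c d j) /\<^sub>R norm (yvec a b c d j))
          \<and> cperp (xvec a b c d 0) (xvec a b c d 1)
          \<and> cperp (yvec a b c d 0) (yvec a b c d 1))"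
proof (intro conjI allI impI set_eqI)
  fix \<psi> :: "complex ^ (2 \<times> 2)"
  \<comment> \<open>Turns membership in the \<open>ppE\<close> family into the description by
    entries in \<open>orthogonal_entangled_iff\<close>.\<close>
  have eq: "\<psi> = ppE a b c d \<longleftrightarrow>
      \<psi> $ (1,1) = 0 \<and> \<psi> $ (1,2) = cnj b * c \<and> \<psi> $ (2,1) = d \<and> \<psi> $ (2,2) = - cnj a * c"
    if "c \<noteq> 0" "d \<noteq> 0" "(cmod c)\<^sup>2 + (cmod d)\<^sup>2 = 1" for c d
    unfolding vec_eq_iff_2x2 using ppE_nth[OF assms(1,2) that(1,2) assms(3) that(3)] by simp
  show "\<psi> \<in> {\<psi>. entangled_state \<psi> \<and> cperp (ket0 \<otimes>\<^sub>v ket0) \<psi>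
            \<and> cperp (a *s (ket0 \<otimes>\<^sub>v ket1) + b *s (ket1 \<otimes>\<^sub>v ket1)) \<psi>}
     \<longleftrightarrow> \<psi> \<in> {ppE a b c d | c d. c \<noteq> 0 \<and> d \<noteq> 0 \<and> (cmod c)\<^sup>2 + (cmod d)\<^sup>2 = 1}"
    unfolding mem_Collect_eq orthogonal_entangled_iff[OF assms] using eq by blast
next
  fix c d
  assume "c \<noteq> 0 \<and> d \<noteq> 0 \<and> (cmod c)\<^sup>2 + (cmod d)\<^sup>2 = 1"
  then have cd: "c \<noteq> 0" "d \<noteq> 0" "(cmod c)\<^sup>2 + (cmod d)\<^sup>2 = 1" by simp_all
  note facts = assms(1,2) cd(1,2) assms(3) cd(3)
  show "schmidt_decomposition (ppE a b c d) {0..1} (kappa b c d)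
          (\<lambda>j. xvec a b c d j /\<^sub>R norm (xvec a b c d j))
          (\<lambda>j. vcnj (yvec a b c d j) /\<^sub>R norm (yvec a b c d j))"
    by (rule schmidt_decomposition_ppE[OF facts])
  show "cperp (xvec a b c d 0) (xvec a b c d 1)" by (rule cperp_xvec[OF facts])
  show "cperp (yvec a b c d 0) (yvec a b c d 1)" by (rule cperp_yvec[OF facts])
qed

end
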